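(* Let $G$ be a finite group acting on a finite nonempty set $X$, let $K$ be the classical Burnside kernel on $X$, $Q$ the dual Burnside kernel on $G^*$, and $A,B$ the matrices defined in the context. Let $\lambda\neq0$. (a) If $v\neq0$ is a function on $X$ with $Kv=\lambda v$, then $Av\neq0$ and $Q(Av)=\lambda Av$. (b) If $w\neq0$ is a function on $G^*$ with $Qw=\lambda w$, then $Bw\neq0$ and $K(Bw)=\lambda Bw$. (c) On the $\lambda$-eigenspaces, $A$ and $B$ are inverse up to the factor $\lambda$: $ABw=\lambda w$ for every $w$ with $Qw=\lambda w$, and $BAv=\lambda v$ for every $v$ with $Kv=\lambda v$.
   Context: For $g\in G$ and $x\in X$ write $X_g:=\{x\in X: g\cdot x=x\}$, $G_x:=\{g\in G: g\cdot x=x\}$, and $G^*:=\{g\in G: X_g\neq\varnothing\}$. The classical Burnside kernel is the $X\times X$ matrix $$K(x,y)=\frac1{|G_x|}\sum_{g\in G_x\cap G_y}\frac1{|X_g|},$$ and the dual Burnside kernel is the $G^*\times G^*$ matrix $$Q(g,h)=\frac1{|X_g|}\sum_{x\in X_g\cap X_h}\frac1{|G_x|}.$$ $A$ is the $G^*\times X$ matrix $A(g,x)=\mathbf 1_{\{x\in X_g\}}/|X_g|$ and $B$ is the $X\times G^*$ matrix $B(x,h)=\mathbf 1_{\{h\in G_x\}}/|G_x|$. Matrices act on functions as column vectors. *)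

theory Defs
  imports "HOL-Algebra.Group_Action"
begin

text \<open>
  An action of \<open>G\<close> on \<open>X\<close> is the library locale \<^locale>\<open>group_action\<close>, with \<open>\<phi> g x\<close> for
  \<open>g \<cdot> x\<close>; \<open>G\<^sub>x\<close> and \<open>X\<^sub>g\<close> are the library's
  \<^const>\<open>stabilizer\<close> and \<^const>\<open>invariants\<close>.
\<close>

definition Gstar ::
    "('g, 'm) monoid_scheme \<Rightarrow> 'x set \<Rightarrow> ('g \<Rightarrow> 'x \<Rightarrow> 'x) \<Rightarrow> 'g set" where
  "Gstar G X \<phi> = {g \<in> carrier G. invariants X \<phi> g \<noteq> {}}"

text \<open>
  Matrices are plain binary functions, read only at indices from the relevant finite sets
  (\<open>X\<close> or \<open>Gstar G X \<phi>\<close>). Their entries are rational, and the scalars range over an arbitrary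
  field of characteristic zero, which includes both \<open>real\<close> and \<open>complex\<close>.
\<close>

definition burnside_K ::
    "('g, 'm) monoid_scheme \<Rightarrow> 'x set \<Rightarrow> ('g \<Rightarrow> 'x \<Rightarrow> 'x) \<Rightarrow> 'x \<Rightarrow> 'x \<Rightarrow> 'k::field_char_0" where
  "burnside_K G X \<phi> x y =
     1 / of_nat (card (stabilizer G \<phi> x)) *
     (\<Sum>g \<in> stabilizer G \<phi> x \<inter> stabilizer G \<phi> y. 1 / of_nat (card (invariants X \<phi> g)))"

definition dual_burnside_Q ::
    "('g, 'm) monoid_scheme \<Rightarrow> 'x set \<Rightarrow> ('g \<Rightarrow> 'x \<Rightarrow> 'x) \<Rightarrow> 'g \<Rightarrow> 'g \<Rightarrow> 'k::field_char_0" where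
  "dual_burnside_Q G X \<phi> g h =
     1 / of_nat (card (invariants X \<phi> g)) *
     (\<Sum>x \<in> invariants X \<phi> g \<inter> invariants X \<phi> h. 1 / of_nat (card (stabilizer G \<phi> x)))"

definition matrix_A ::
    "'x set \<Rightarrow> ('g \<Rightarrow> 'x \<Rightarrow> 'x) \<Rightarrow> 'g \<Rightarrow> 'x \<Rightarrow> 'k::field_char_0" where
  "matrix_A X \<phi> g x =
     (if x \<in> invariants X \<phi> g then 1 else 0) / of_nat (card (invariants X \<phi> g))"

definition matrix_B ::
    "('g, 'm) monoid_scheme \<Rightarrow> ('g \<Rightarrow> 'x \<Rightarrow> 'x) \<Rightarrow> 'x \<Rightarrow> 'g \<Rightarrow> 'k::field_char_0" where
  "matrix_B G \<phi> x h =
     (if h \<in> stabilizer G \<phi> x then 1 else 0) / of_nat (card (stabilizer G \<phi> x))"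

text \<open>The column set \<open>J\<close> has to be given explicitly, since \<open>M\<close> does not determine it.\<close>

definition mat_app :: "'j set \<Rightarrow> ('i \<Rightarrow> 'j \<Rightarrow> 'k::field_char_0) \<Rightarrow> ('j \<Rightarrow> 'k) \<Rightarrow> 'i \<Rightarrow> 'k" where
  "mat_app J M v = (\<lambda>i. \<Sum>j\<in>J. M i j * v j)"

text \<open>
  A function on an index set \<open>S\<close> is represented by a total function whose values outside \<open>S\<close>
  are irrelevant, so identities between functions on \<open>S\<close> (including being nonzero) are
  asserted pointwise on \<open>S\<close> only.
\<close>

definition nonzero_on :: "'i set \<Rightarrow> ('i \<Rightarrow> 'k::field_char_0) \<Rightarrow> bool" where
  "nonzero_on S v \<longleftrightarrow> (\<exists>i\<in>S. v i \<noteq> 0)"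

definition eigen_eq :: "'i set \<Rightarrow> ('i \<Rightarrow> 'i \<Rightarrow> 'k::field_char_0) \<Rightarrow> 'k \<Rightarrow> ('i \<Rightarrow> 'k) \<Rightarrow> bool" where
  "eigen_eq S M c v \<longleftrightarrow> (\<forall>i\<in>S. mat_app S M v i = c * v i)"

end

theory Submission
  imports Defs
begin

text \<open>
  The kernels factor as \<open>K = B A\<close> and \<open>Q = A B\<close>. For any two products \<open>M N\<close> and \<open>N M\<close>, the map \<open>N\<close>
  carries eigenvectors of \<open>M N\<close> to eigenvectors of \<open>N M\<close> with the same eigenvalue \<open>c\<close>, and
  \<open>M (N v) = c v\<close> forces \<open>N v \<noteq> 0\<close> whenever \<open>c v \<noteq> 0\<close>.
\<close>

text \<open>Associativity of the matrix action, by exchanging two finite sums. The factorization of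
  \<open>P\<close> is assumed only for the row \<open>i\<close> and columns in \<open>I\<close>,
  because the Burnside kernels factor only on their index sets.\<close>

lemma mat_app_mult:
  assumes "\<And>k. k \<in> I \<Longrightarrow> P i k = (\<Sum>j\<in>J. M i j * N j k)"
  shows "mat_app J M (mat_app I N v) i = mat_app I P v i"
proof -
  have "mat_app J M (mat_app I N v) i = (\<Sum>j\<in>J. \<Sum>k\<in>I. M i j * N j k * v k)"
    by (simp add: mat_app_def sum_distrib_left mult.assoc)
  also have "\<dots> = (\<Sum>k\<in>I. \<Sum>j\<in>J. M i j * N j k * v k)"
    by (rule sum.swap)
  also have "\<dots> = mat_app I P v i"
    by (simp add: mat_app_def assms sum_distrib_right)
  finally show ?thesis .
qed

text \<open>Used with either order of the factors, this is the inverse relation up to the factor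
  \<open>c\<close>; the next two lemmas also rest on it.\<close>

lemma eigen_eq_mult:
  assumes "\<And>i k. i \<in> I \<Longrightarrow> k \<in> I \<Longrightarrow> P i k = (\<Sum>j\<in>J. M i j * N j k)"
    and "eigen_eq I P c v" and "i \<in> I"
  shows "mat_app J M (mat_app I N v) i = c * v i"
  using assms mat_app_mult[of I P i M N J v] by (simp add: eigen_eq_def)

text \<open>Regrouping gives \<open>(N M) (N v) = N ((M N) v) = N (c v)\<close>, and the scalar
  comes out by linearity.\<close>

lemma eigen_eq_swap:
  assumes P: "\<And>i k. i \<in> I \<Longrightarrow> k \<in> I \<Longrightarrow> P i k = (\<Sum>j\<in>J. M i j * N j k)"
    and R: "\<And>j l. j \<in> J \<Longrightarrow> l \<in> J \<Longrightarrow> R j l = (\<Sum>i\<in>I. N j i * M i l)"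
    and v: "eigen_eq I P c v"
  shows "eigen_eq J R c (mat_app I N v)"
  unfolding eigen_eq_def
proof
  fix j assume "j \<in> J"
  have "mat_app J R (mat_app I N v) j = mat_app I N (mat_app J M (mat_app I N v)) j"
    by (rule mat_app_mult[symmetric]) (simp add: R \<open>j \<in> J\<close>)
  also have "\<dots> = (\<Sum>i\<in>I. N j i * (c * v i))"
    \<comment> \<open>The explicit instance unfolds only the outer application, so the inner
      \<open>M (N v)\<close> keeps the shape that \<open>eigen_eq_mult\<close> rewrites.\<close>
    unfolding mat_app_def[of I N "mat_app J M (mat_app I N v)"]
    by (rule sum.cong) (simp_all add: eigen_eq_mult[OF P v])
  also have "\<dots> = c * mat_app I N v j"
    by (simp add: mat_app_def sum_distrib_left mult.left_commute)
  finally show "mat_app J R (mat_app I N v) j = c * mat_app I N v j" .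
qed

lemma nonzero_on_eigen_eq:
  assumes P: "\<And>i k. i \<in> I \<Longrightarrow> k \<in> I \<Longrightarrow> P i k = (\<Sum>j\<in>J. M i j * N j k)"
    and v: "eigen_eq I P c v" "nonzero_on I v" and "c \<noteq> 0"
  shows "nonzero_on J (mat_app I N v)"
proof (rule ccontr)
  assume "\<not> ?thesis"
  \<comment> \<open>\<open>M\<close> reads \<open>N v\<close> only at indices in \<open>J\<close>,
    where it is assumed to vanish.\<close>
  then have "mat_app J M (mat_app I N v) i = 0" for i
    unfolding nonzero_on_def mat_app_def[of J M] by simp
  then show False
    using eigen_eq_mult[OF P v(1)] v(2) \<open>c \<noteq> 0\<close> by (auto simp: nonzero_on_def)
qed

text \<open>The two indicators in \<open>B x g * A g y\<close> select the \<open>g\<close> that fix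
  both \<open>x\<close> and \<open>y\<close>. Each such \<open>g\<close> lies in
  \<open>Gstar\<close>, having \<open>x\<close> as a fixed point, so summing over
  \<open>Gstar\<close> loses no term of the kernel.\<close>

lemma burnside_K_eq_mult:
  assumes "finite (carrier G)" and "x \<in> X" "y \<in> X"
  shows "burnside_K G X \<phi> x y = (\<Sum>g\<in>Gstar G X \<phi>. matrix_B G \<phi> x g * matrix_A X \<phi> g y)"
proof -
  have "stabilizer G \<phi> x \<inter> stabilizer G \<phi> y =
      {g \<in> Gstar G X \<phi>. g \<in> stabilizer G \<phi> x \<and> y \<in> invariants X \<phi> g}"
    using assms by (auto simp: Gstar_def stabilizer_def invariants_def)
  moreover have "finite (Gstar G X \<phi>)"
    using assms(1) by (simp add: Gstar_def)
  ultimately show ?thesis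
    \<comment> \<open>\<open>sum.inter_filter\<close> turns the sum over the filtered set into a sum
      over all of \<open>Gstar\<close> with a conditional summand, which is then compared with the
      product of indicators termwise.\<close>
    by (simp only: burnside_K_def sum_distrib_left sum.inter_filter)
      (rule sum.cong, simp_all add: matrix_A_def matrix_B_def)
qed

text \<open>Dual count: for \<open>h\<close> in the group, \<open>h\<close> stabilizes a point
  \<open>x\<close> of \<open>X\<close> exactly when \<open>x\<close> is invariant under
  \<open>h\<close>, so the indicators select the common fixed points of \<open>g\<close> and
  \<open>h\<close>.\<close>

lemma dual_burnside_Q_eq_mult:
  assumes "finite X" and "g \<in> Gstar G X \<phi>" "h \<in> Gstar G X \<phi>"
  shows "dual_burnside_Q G X \<phi> g h = (\<Sum>x\<in>X. matrix_A X \<phi> g x * matrix_B G \<phi> x h)"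
proof -
  have "invariants X \<phi> g \<inter> invariants X \<phi> h =
      {x \<in> X. x \<in> invariants X \<phi> g \<and> h \<in> stabilizer G \<phi> x}"
    using assms by (auto simp: Gstar_def stabilizer_def invariants_def)
  then show ?thesis
    using assms(1)
    by (simp only: dual_burnside_Q_def sum_distrib_left sum.inter_filter)
      (rule sum.cong, simp_all add: matrix_A_def matrix_B_def)
qed

theorem theorem3p8:
  fixes G :: "('g, 'm) monoid_scheme"
    and X :: "'x set"
    and \<phi> :: "'g \<Rightarrow> 'x \<Rightarrow> 'x"
    and c :: "'k::field_char_0"
  defines "K \<equiv> burnside_K G X \<phi> :: 'x \<Rightarrow> 'x \<Rightarrow> 'k"
    and "Q \<equiv> dual_burnside_Q G X \<phi> :: 'g \<Rightarrow> 'g \<Rightarrow> 'k"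
    and "A \<equiv> matrix_A X \<phi> :: 'g \<Rightarrow> 'x \<Rightarrow> 'k"
    and "B \<equiv> matrix_B G \<phi> :: 'x \<Rightarrow> 'g \<Rightarrow> 'k"
    and "Gs \<equiv> Gstar G X \<phi>"
  assumes "group_action G X \<phi>"
    and "finite (carrier G)"
    and "finite X"
    and "X \<noteq> {}"
    and "c \<noteq> 0"
  shows "(\<forall>v. nonzero_on X v \<and> eigen_eq X K c v \<longrightarrow>
              nonzero_on Gs (mat_app X A v) \<and> eigen_eq Gs Q c (mat_app X A v))
       \<and> (\<forall>w. nonzero_on Gs w \<and> eigen_eq Gs Q c w \<longrightarrow>
              nonzero_on X (mat_app Gs B w) \<and> eigen_eq X K c (mat_app Gs B w))
       \<and> (\<forall>w. eigen_eq Gs Q c w \<longrightarrow>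
              (\<forall>g\<in>Gs. mat_app X A (mat_app Gs B w) g = c * w g))
       \<and> (\<forall>v. eigen_eq X K c v \<longrightarrow>
              (\<forall>x\<in>X. mat_app Gs B (mat_app X A v) x = c * v x))"
proof -
  have K: "K x y = (\<Sum>g\<in>Gs. B x g * A g y)" if "x \<in> X" "y \<in> X" for x y
    unfolding K_def A_def B_def Gs_def using \<open>finite (carrier G)\<close> that by (rule burnside_K_eq_mult)
  have Q: "Q g h = (\<Sum>x\<in>X. A g x * B x h)" if "g \<in> Gs" "h \<in> Gs" for g h
    unfolding Q_def A_def B_def using \<open>finite X\<close> that[unfolded Gs_def]
    by (rule dual_burnside_Q_eq_mult)
  \<comment> \<open>Here \<open>M\<close> is \<open>B\<close> and \<open>N\<close> is
    \<open>A\<close>; in \<open>w\<close> the roles are exchanged. Each list supplies the eigenvalue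
    equation, nonvanishing and inversion up to \<open>c\<close>.\<close>
  note v = eigen_eq_swap[where P = K and R = Q, OF K Q]
    nonzero_on_eigen_eq[where P = K, OF K _ _ \<open>c \<noteq> 0\<close>]
    eigen_eq_mult[where P = K, OF K]
  note w = eigen_eq_swap[where P = Q and R = K, OF Q K]
    nonzero_on_eigen_eq[where P = Q, OF Q _ _ \<open>c \<noteq> 0\<close>]
    eigen_eq_mult[where P = Q, OF Q]
  show ?thesis
    by (intro conjI allI impI ballI; (elim conjE)?; rule v w; assumption)
qed

end
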